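(* Let $n\ge 1$ be a positive integer. If $L$ is a non-unitary contraction in $\mathfrak{L}_n$, then $$\lim_{k\to\infty}\|(L^* )^k\xi\|=0\quad\text{for all }\xi\in\mathcal{H}_n.$$
   Context: Let $\mathcal{F}_n$ be the unital free semigroup on $n$ generators $z_1,\dots,z_n$ (its unit is the empty word $1$), and let $\mathcal{H}_n=\ell_2(\mathcal{F}_n)$, with orthonormal basis $\{\xi_w: w\in\mathcal{F}_n\}$. For $w\in\mathcal{F}_n$ let $L_w$ be the isometry on $\mathcal{H}_n$ with $L_w\xi_v=\xi_{wv}$, and put $L_i=L_{z_i}$. The non-commutative analytic Toeplitz algebra $\mathfrak{L}_n$ is the unital algebra, closed in the weak operator topology, generated by $L_1,\dots,L_n$ in $\mathcal{B}(\mathcal{H}_n)$. *)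

theory Defs
  imports "HOL-Analysis.Analysis"
begin

section \<open>The complex Hilbert space of square-summable families\<close>

typedef 'a ell2 = "{f :: 'a \<Rightarrow> complex. (\<lambda>w. (cmod (f w))\<^sup>2) summable_on UNIV}"
  morphisms ell2_nth Abs_ell2
  by (rule exI[of _ "\<lambda>_. 0"]) simp

setup_lifting type_definition_ell2

lemma ell2_eqI: "(\<And>w. ell2_nth f w = ell2_nth g w) \<Longrightarrow> f = g"
  by (simp add: ell2_nth_inject[symmetric] fun_eq_iff)

lemma ell2_summable: "(\<lambda>w. (cmod (ell2_nth f w))\<^sup>2) summable_on UNIV"
  using ell2_nth[of f] by simp

lemma square_summable_add:
  fixes f g :: "'a \<Rightarrow> complex"
  assumes "(\<lambda>w. (cmod (f w))\<^sup>2) summable_on UNIV" "(\<lambda>w. (cmod (g w))\<^sup>2) summable_on UNIV"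
  shows "(\<lambda>w. (cmod (f w + g w))\<^sup>2) summable_on UNIV"
proof (rule summable_on_comparison_test)
  show "(\<lambda>w. 2 * (cmod (f w))\<^sup>2 + 2 * (cmod (g w))\<^sup>2) summable_on UNIV"
    by (intro summable_on_add summable_on_cmult_right assms)
  fix w
  have "(cmod (f w + g w))\<^sup>2 \<le> (cmod (f w) + cmod (g w))\<^sup>2"
    by (simp add: norm_triangle_ineq power_mono)
  also have "\<dots> \<le> 2 * (cmod (f w))\<^sup>2 + 2 * (cmod (g w))\<^sup>2"
    using sum_squares_bound[of "cmod (f w)" "cmod (g w)"] by (simp add: power2_sum)
  finally show "(cmod (f w + g w))\<^sup>2 \<le> 2 * (cmod (f w))\<^sup>2 + 2 * (cmod (g w))\<^sup>2" .
qed auto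

lemma square_summable_scale:
  fixes f :: "'a \<Rightarrow> complex"
  assumes "(\<lambda>w. (cmod (f w))\<^sup>2) summable_on UNIV"
  shows "(\<lambda>w. (cmod (c * f w))\<^sup>2) summable_on UNIV"
  unfolding norm_mult power_mult_distrib by (intro summable_on_cmult_right assms)

lift_definition cscale :: "complex \<Rightarrow> 'a ell2 \<Rightarrow> 'a ell2" is "\<lambda>c f w. c * f w"
  using square_summable_scale by auto

lemma cinner_abs_summable:
  "(\<lambda>w. cmod (ell2_nth f w * cnj (ell2_nth g w))) summable_on UNIV"
proof (rule summable_on_comparison_test)
  show "(\<lambda>w. (cmod (ell2_nth f w))\<^sup>2 + (cmod (ell2_nth g w))\<^sup>2) summable_on UNIV"
    by (intro summable_on_add ell2_summable)
  fix w
  show "cmod (ell2_nth f w * cnj (ell2_nth g w))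
      \<le> (cmod (ell2_nth f w))\<^sup>2 + (cmod (ell2_nth g w))\<^sup>2"
    using sum_squares_bound[of "cmod (ell2_nth f w)" "cmod (ell2_nth g w)"]
      mult_nonneg_nonneg[OF norm_ge_zero[of "ell2_nth f w"] norm_ge_zero[of "ell2_nth g w"]]
    unfolding norm_mult complex_mod_cnj by linarith
qed auto

lemma cinner_summable: "(\<lambda>w. ell2_nth f w * cnj (ell2_nth g w)) summable_on UNIV"
  using cinner_abs_summable by (rule abs_summable_summable)

definition cinner :: "'a ell2 \<Rightarrow> 'a ell2 \<Rightarrow> complex" where
  "cinner f g = (\<Sum>\<^sub>\<infinity>w. ell2_nth f w * cnj (ell2_nth g w))"

instantiation ell2 :: (type) real_vector
begin

lift_definition zero_ell2 :: "'a ell2" is "\<lambda>_. 0" by simp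

lift_definition plus_ell2 :: "'a ell2 \<Rightarrow> 'a ell2 \<Rightarrow> 'a ell2" is "\<lambda>f g w. f w + g w"
  using square_summable_add by auto

lift_definition uminus_ell2 :: "'a ell2 \<Rightarrow> 'a ell2" is "\<lambda>f w. - f w" by simp

lift_definition minus_ell2 :: "'a ell2 \<Rightarrow> 'a ell2 \<Rightarrow> 'a ell2" is "\<lambda>f g w. f w - g w"
  using square_summable_add[of _ "\<lambda>w. - g w" for g] by auto

lift_definition scaleR_ell2 :: "real \<Rightarrow> 'a ell2 \<Rightarrow> 'a ell2" is "\<lambda>r f w. r *\<^sub>R f w"
  unfolding scaleR_conv_of_real using square_summable_scale by auto

instance
proof
  fix x y z :: "'a ell2" and r s :: real
  show "x + y + z = x + (y + z)" "x + y = y + x" "0 + x = x" "- x + x = 0" "x - y = x + - y"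
    by (transfer; simp add: algebra_simps)+
  show "r *\<^sub>R (x + y) = r *\<^sub>R x + r *\<^sub>R y" "(r + s) *\<^sub>R x = r *\<^sub>R x + s *\<^sub>R x"
    "r *\<^sub>R s *\<^sub>R x = (r * s) *\<^sub>R x" "1 *\<^sub>R x = x"
    by (transfer; simp add: algebra_simps)+
qed

end

instantiation ell2 :: (type) real_inner
begin

definition inner_ell2 :: "'a ell2 \<Rightarrow> 'a ell2 \<Rightarrow> real" where
  "inner_ell2 f g = Re (cinner f g)"

definition norm_ell2 :: "'a ell2 \<Rightarrow> real" where
  "norm_ell2 f = sqrt (\<Sum>\<^sub>\<infinity>w. (cmod (ell2_nth f w))\<^sup>2)"

definition dist_ell2 :: "'a ell2 \<Rightarrow> 'a ell2 \<Rightarrow> real" where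
  "dist_ell2 f g = norm (f - g)"

definition sgn_ell2 :: "'a ell2 \<Rightarrow> 'a ell2" where
  "sgn_ell2 f = f /\<^sub>R norm f"

definition uniformity_ell2 :: "('a ell2 \<times> 'a ell2) filter" where
  "uniformity_ell2 = (INF e\<in>{0<..}. principal {(x, y). dist x y < e})"

definition open_ell2 :: "'a ell2 set \<Rightarrow> bool" where
  "open_ell2 U = (\<forall>x\<in>U. eventually (\<lambda>(x', y). x' = x \<longrightarrow> y \<in> U) uniformity)"

instance
proof
  have inner_eq: "inner f g = (\<Sum>\<^sub>\<infinity>w. Re (ell2_nth f w * cnj (ell2_nth g w)))" for f g :: "'a ell2"
    unfolding inner_ell2_def cinner_def by (rule infsum_Re[symmetric, OF cinner_summable])
  have summ: "(\<lambda>w. Re (ell2_nth f w * cnj (ell2_nth g w))) summable_on UNIV" for f g :: "'a ell2"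
    by (rule summable_on_Re[OF cinner_summable])
  have self: "inner f f = (\<Sum>\<^sub>\<infinity>w. (cmod (ell2_nth f w))\<^sup>2)" for f :: "'a ell2"
    unfolding inner_eq by (simp only: cmod_power2) (simp add: power2_eq_square)
  fix x y z :: "'a ell2" and r :: real
  show "dist x y = norm (x - y)" by (fact dist_ell2_def)
  show "sgn x = x /\<^sub>R norm x" by (fact sgn_ell2_def)
  show "(uniformity :: ('a ell2 \<times> 'a ell2) filter)
      = (INF e\<in>{0<..}. principal {(x, y). dist x y < e})" by (fact uniformity_ell2_def)
  show "open U = (\<forall>x\<in>U. eventually (\<lambda>(x', y). x' = x \<longrightarrow> y \<in> U) uniformity)"
    for U :: "'a ell2 set" by (fact open_ell2_def)
  show "inner x y = inner y x"
    unfolding inner_eq by (simp add: mult.commute)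
  show "inner (x + y) z = inner x z + inner y z"
    unfolding inner_eq infsum_add[OF summ summ, symmetric]
    by (simp add: plus_ell2.rep_eq algebra_simps)
  show "inner (r *\<^sub>R x) y = r * inner x y"
    unfolding inner_eq infsum_cmult_right'[symmetric]
    by (simp add: scaleR_ell2.rep_eq algebra_simps)
  show "0 \<le> inner x x"
    unfolding self by (simp add: infsum_nonneg)
  show "inner x x = 0 \<longleftrightarrow> x = 0"
  proof
    assume "inner x x = 0"
    then have "(cmod (ell2_nth x w))\<^sup>2 = 0" for w
      unfolding self by (intro nonneg_infsum_le_0D[OF _ ell2_summable]) auto
    then show "x = 0"
      by (intro ell2_eqI) (simp add: zero_ell2.rep_eq)
  qed (simp add: self zero_ell2.rep_eq)
  show "norm x = sqrt (inner x x)"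
    unfolding self norm_ell2_def ..
qed

end

lemma norm_cscale: "norm (cscale c f) = cmod c * norm f"
  by (simp add: norm_ell2_def cscale.rep_eq norm_mult power_mult_distrib infsum_cmult_right'
      real_sqrt_mult)

lift_definition ket :: "'a \<Rightarrow> 'a ell2" is "\<lambda>v w. if w = v then 1 else 0"
proof -
  fix v :: 'a
  have "(\<lambda>w. (cmod (if w = v then 1 else 0))\<^sup>2) summable_on UNIV"
    by (rule finite_nonzero_values_imp_summable_on) simp
  then show "(\<lambda>w. (cmod (if w = v then 1 else 0))\<^sup>2) summable_on UNIV" .
qed

section \<open>Bounded operators\<close>

(* Elements of the type of bounded linear functions are only real-linear. *)
definition bounded_ops :: "('a ell2 \<Rightarrow>\<^sub>L 'a ell2) set" where
  "bounded_ops = {T :: 'a ell2 \<Rightarrow>\<^sub>L 'a ell2. \<forall>c x. T (cscale c x) = cscale c (T x)}"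

lift_definition scalar_op :: "complex \<Rightarrow> 'a ell2 \<Rightarrow>\<^sub>L 'a ell2" is cscale
proof (rule bounded_linear_intro)
  fix c :: complex and x y :: "'a ell2" and r :: real
  show "cscale c (x + y) = cscale c x + cscale c y" "cscale c (r *\<^sub>R x) = r *\<^sub>R cscale c x"
    by (transfer; simp add: algebra_simps)+
  show "norm (cscale c x) \<le> norm x * cmod c"
    by (simp add: norm_cscale)
qed

lemma cinner_add_left: "cinner (f + g) h = cinner f h + cinner g h"
  unfolding cinner_def infsum_add[OF cinner_summable cinner_summable, symmetric]
  by (simp add: plus_ell2.rep_eq algebra_simps)

lemma cinner_cscale_left: "cinner (cscale c f) g = c * cinner f g"
  unfolding cinner_def infsum_cmult_right'[symmetric]
  by (simp add: cscale.rep_eq algebra_simps)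

lemma cinner_commute: "cinner g f = cnj (cinner f g)"
  unfolding cinner_def infsum_cnj[symmetric] by (simp add: mult.commute)

lemma norm_ell2_sq: "(norm f)\<^sup>2 = (\<Sum>\<^sub>\<infinity>w. (cmod (ell2_nth f w))\<^sup>2)"
  by (simp add: norm_ell2_def infsum_nonneg)

lemma Re_cinner_le: "Re (cinner f g) \<le> norm f * norm g"
  using norm_cauchy_schwarz[of f g] by (simp add: inner_ell2_def)

lemma cmod_cinner_le: "cmod (cinner f g) \<le> norm f * norm g"
proof (cases "cinner f g = 0")
  case False
  define c where "c = cnj (cinner f g) / cmod (cinner f g)"
  have c: "cmod c = 1" using False by (simp add: c_def norm_divide)
  have "cinner (cscale c f) g = cmod (cinner f g)"
    using False complex_norm_square[of "cinner f g"]
    by (simp add: cinner_cscale_left c_def divide_simps power2_eq_square mult.commute)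
  then have "cmod (cinner f g) = Re (cinner (cscale c f) g)" by simp
  also have "\<dots> \<le> norm f * norm g"
    using Re_cinner_le[of "cscale c f" g] by (simp add: norm_cscale c)
  finally show ?thesis .
qed simp

lemma cinner_ket_left: "cinner (ket w) f = cnj (ell2_nth f w)"
proof -
  have "cinner (ket w) f = (\<Sum>\<^sub>\<infinity>v\<in>{w}. cnj (ell2_nth f v))"
    unfolding cinner_def by (rule infsum_cong_neutral) (auto simp: ket.rep_eq)
  then show ?thesis by simp
qed

definition ell2_trunc :: "'a set \<Rightarrow> ('a \<Rightarrow> complex) \<Rightarrow> 'a ell2" where
  "ell2_trunc F c = (\<Sum>w\<in>F. cscale (c w) (ket w))"

lemma ell2_nth_sum: "ell2_nth (sum f A) w = (\<Sum>i\<in>A. ell2_nth (f i) w)"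
  by (induction A rule: infinite_finite_induct) (auto simp: zero_ell2.rep_eq plus_ell2.rep_eq)

lemma ell2_nth_trunc: "finite F \<Longrightarrow> ell2_nth (ell2_trunc F c) w = (if w \<in> F then c w else 0)"
  by (simp add: ell2_trunc_def ell2_nth_sum cscale.rep_eq ket.rep_eq if_distrib cong: if_cong)

lemma cinner_sum_left: "cinner (sum f A) g = (\<Sum>i\<in>A. cinner (f i) g)"
proof -
  have "cinner 0 g = 0" by (simp add: cinner_def zero_ell2.rep_eq)
  then show ?thesis
    by (induction A rule: infinite_finite_induct) (simp_all add: cinner_add_left)
qed

lemma cinner_op_trunc:
  assumes "T \<in> bounded_ops"
  shows "cinner (blinfun_apply T (ell2_trunc F c)) y = (\<Sum>w\<in>F. c w * cinner (T (ket w)) y)"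
  using assms
  by (simp add: ell2_trunc_def blinfun.sum_right bounded_ops_def cinner_sum_left cinner_cscale_left)

lemma norm_trunc_sq:
  assumes "finite F"
  shows "(norm (ell2_trunc F c))\<^sup>2 = (\<Sum>w\<in>F. (cmod (c w))\<^sup>2)"
proof -
  have "(norm (ell2_trunc F c))\<^sup>2 = (\<Sum>\<^sub>\<infinity>w\<in>F. (cmod (c w))\<^sup>2)"
    unfolding norm_ell2_sq using assms
    by (intro infsum_cong_neutral) (auto simp: ell2_nth_trunc)
  then show ?thesis using assms by simp
qed

lemma trunc_tendsto:
  "((\<lambda>F. ell2_trunc F (ell2_nth f)) \<longlongrightarrow> f) (finite_subsets_at_top UNIV)"
proof -
  have eq: "(norm (ell2_trunc F (ell2_nth f) - f))\<^sup>2
      = (norm f)\<^sup>2 - (\<Sum>w\<in>F. (cmod (ell2_nth f w))\<^sup>2)" if "finite F" for F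
  proof -
    have "(norm (ell2_trunc F (ell2_nth f) - f))\<^sup>2
        = (\<Sum>\<^sub>\<infinity>w\<in>UNIV - F. (cmod (ell2_nth f w))\<^sup>2)"
      unfolding norm_ell2_sq using that
      by (intro infsum_cong_neutral) (auto simp: minus_ell2.rep_eq ell2_nth_trunc)
    also have "\<dots> = (norm f)\<^sup>2 - (\<Sum>\<^sub>\<infinity>w\<in>F. (cmod (ell2_nth f w))\<^sup>2)"
      unfolding norm_ell2_sq using that by (intro infsum_Diff ell2_summable) auto
    finally show ?thesis using that by simp
  qed
  have "((\<lambda>F. (norm f)\<^sup>2 - (\<Sum>w\<in>F. (cmod (ell2_nth f w))\<^sup>2)) \<longlongrightarrow> (norm f)\<^sup>2 - (norm f)\<^sup>2)
      (finite_subsets_at_top UNIV)"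
    using has_sum_infsum[OF ell2_summable[of f]]
    by (intro tendsto_intros) (simp add: has_sum_def norm_ell2_sq)
  then have "((\<lambda>F. (norm (ell2_trunc F (ell2_nth f) - f))\<^sup>2) \<longlongrightarrow> 0) (finite_subsets_at_top UNIV)"
    by (subst tendsto_cong[OF eventually_finite_subsets_at_top_weakI[OF eq]]) simp_all
  then have "((\<lambda>F. norm (ell2_trunc F (ell2_nth f) - f)) \<longlongrightarrow> 0) (finite_subsets_at_top UNIV)"
    using tendsto_real_sqrt by fastforce
  then show ?thesis
    by (simp add: LIM_zero_iff tendsto_norm_zero_iff)
qed

lemma bounded_linear_cinner_left: "bounded_linear (\<lambda>f. cinner f (g :: 'a ell2))"
proof (rule bounded_linear_intro)
  fix r :: real and f :: "'a ell2"
  have "r *\<^sub>R f = cscale (of_real r) f" by transfer (simp add: scaleR_conv_of_real)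
  then show "cinner (r *\<^sub>R f) g = r *\<^sub>R cinner f g"
    by (simp add: cinner_cscale_left scaleR_conv_of_real)
qed (rule cinner_add_left cmod_cinner_le)+

lemma adjoint_op_unique:
  assumes "\<And>x y. cinner x (blinfun_apply S y) = cinner x (blinfun_apply S' y)"
  shows "S = S'"
proof (rule blinfun_eqI, rule ell2_eqI)
  show "ell2_nth (S y) w = ell2_nth (S' y) w" for y w
    using assms[of "ket w" y] by (simp add: cinner_ket_left)
qed

lemma adjoint_op_exists:
  fixes T :: "'a ell2 \<Rightarrow>\<^sub>L 'a ell2"
  assumes T: "T \<in> bounded_ops"
  shows "\<exists>S\<in>bounded_ops. \<forall>x y. cinner (blinfun_apply T x) y = cinner x (blinfun_apply S y)"
proof -
  define h where "h y w = cnj (cinner (T (ket w)) y)" for y w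
  define s where "s y = Abs_ell2 (h y)" for y
  have bound: "(\<Sum>w\<in>F. (cmod (h y w))\<^sup>2) \<le> (norm T * norm y)\<^sup>2" if F: "finite F" for F y
  proof -
    let ?x = "ell2_trunc F (h y)"
    have "(norm ?x)\<^sup>2 = cmod (\<Sum>w\<in>F. h y w * cnj (h y w))"
      unfolding norm_trunc_sq[OF F] complex_norm_square[symmetric] of_real_sum[symmetric]
        norm_of_real by (simp add: sum_nonneg)
    also have "\<dots> = cmod (cinner (T ?x) y)"
      by (simp add: cinner_op_trunc[OF T] h_def)
    also have "\<dots> \<le> norm (T ?x) * norm y"
      by (rule cmod_cinner_le)
    also have "\<dots> \<le> (norm T * norm ?x) * norm y"
      by (intro mult_right_mono norm_blinfun) simp
    finally have "norm ?x * norm ?x \<le> (norm T * norm y) * norm ?x"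
      by (simp add: power2_eq_square mult_ac)
    then have "norm ?x \<le> norm T * norm y"
      by (cases "norm ?x = 0") (auto simp del: norm_eq_zero simp: mult_le_cancel_right)
    then show ?thesis
      unfolding norm_trunc_sq[OF F, symmetric] by (simp add: power_mono)
  qed
  have summ: "(\<lambda>w. (cmod (h y w))\<^sup>2) summable_on UNIV" for y
    by (rule nonneg_bdd_above_summable_on) (auto intro!: bdd_aboveI2 bound)
  then have nth: "ell2_nth (s y) = h y" for y
    unfolding s_def by (simp add: Abs_ell2_inverse)
  have norm_s: "norm (s y) \<le> norm T * norm y" for y
  proof (rule power2_le_imp_le)
    show "(norm (s y))\<^sup>2 \<le> (norm T * norm y)\<^sup>2"
      unfolding norm_ell2_sq nth by (intro infsum_le_finite_sums summ bound)
  qed simp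
  have right: "cinner f (g + g') = cinner f g + cinner f g'"
    "cinner f (cscale c g) = cnj c * cinner f g" for f g g' :: "'a ell2" and c
    by (simp_all add: cinner_commute[of f] cinner_add_left cinner_cscale_left)
  have real: "r *\<^sub>R f = cscale (of_real r) f" for r and f :: "'a ell2"
    by transfer (simp add: scaleR_conv_of_real)
  have s_add: "s (x + y) = s x + s y" for x y
    by (rule ell2_eqI) (simp add: nth plus_ell2.rep_eq h_def right)
  have s_scale: "s (cscale c x) = cscale c (s x)" for c x
    by (rule ell2_eqI) (simp add: nth cscale.rep_eq h_def right)
  have lin: "bounded_linear s"
    by (rule bounded_linear_intro[where K = "norm T"])
      (use norm_s in \<open>simp_all add: s_add s_scale real mult.commute\<close>)
  have "cinner (T x) y = cinner x (s y)" for x y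
  proof (rule tendsto_unique)
    show "((\<lambda>F. cinner (T (ell2_trunc F (ell2_nth x))) y) \<longlongrightarrow> cinner (T x) y)
        (finite_subsets_at_top UNIV)"
      by (intro bounded_linear.tendsto[OF bounded_linear_cinner_left] tendsto_intros trunc_tendsto)
    show "((\<lambda>F. cinner (T (ell2_trunc F (ell2_nth x))) y) \<longlongrightarrow> cinner x (s y))
        (finite_subsets_at_top UNIV)"
      using has_sum_infsum[OF cinner_summable[of x "s y"]]
      by (simp add: cinner_op_trunc[OF T] has_sum_def cinner_def[of x] nth h_def)
  qed simp
  then show ?thesis
    using lin s_scale
    by (intro bexI[of _ "Blinfun s"]) (auto simp: bounded_ops_def bounded_linear_Blinfun_apply)
qed

lemma adjoint_op_ex1:
  assumes "T \<in> bounded_ops"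
  shows "\<exists>!S. S \<in> bounded_ops \<and> (\<forall>x y. cinner (blinfun_apply T x) y = cinner x (blinfun_apply S y))"
  using adjoint_op_exists[OF assms] by (auto intro: adjoint_op_unique)

definition cadjoint :: "('a ell2 \<Rightarrow>\<^sub>L 'a ell2) \<Rightarrow> 'a ell2 \<Rightarrow>\<^sub>L 'a ell2" where
  "cadjoint T = (THE S. S \<in> bounded_ops \<and> (\<forall>x y. cinner (T x) y = cinner x (S y)))"

definition unitary_op :: "('a ell2 \<Rightarrow>\<^sub>L 'a ell2) \<Rightarrow> bool" where
  "unitary_op U \<longleftrightarrow> U \<in> bounded_ops \<and>
     cadjoint U o\<^sub>L U = id_blinfun \<and> U o\<^sub>L cadjoint U = id_blinfun"

(* The coarsest topology on bounded_ops making every matrix coefficient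
   T \<mapsto> cinner (T x) y continuous: the function space carries the product topology. *)
definition weak_operator_topology :: "('a ell2 \<Rightarrow>\<^sub>L 'a ell2) topology" where
  "weak_operator_topology =
     pullback_topology bounded_ops (\<lambda>T (x, y). cinner (T x) y) euclidean"

definition unital_subalgebra :: "('a ell2 \<Rightarrow>\<^sub>L 'a ell2) set \<Rightarrow> bool" where
  "unital_subalgebra A \<longleftrightarrow> A \<subseteq> bounded_ops \<and> id_blinfun \<in> A \<and>
     (\<forall>S\<in>A. \<forall>T\<in>A. S + T \<in> A \<and> S o\<^sub>L T \<in> A) \<and>
     (\<forall>c. \<forall>T\<in>A. scalar_op c o\<^sub>L T \<in> A)"

section \<open>The non-commutative analytic Toeplitz algebra\<close>

text \<open>
  The free semigroup on the letters of a finite type \<open>'n\<close> is \<open>'n list\<close> with concatenation;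
  the number of generators is \<open>CARD('n)\<close>.
\<close>

lift_definition left_shift :: "'n list \<Rightarrow> 'n list ell2 \<Rightarrow> 'n list ell2" is
  "\<lambda>w f v. if take (length w) v = w then f (drop (length w) v) else 0"
proof -
  fix w :: "'n list" and f :: "'n list \<Rightarrow> complex"
  let ?g = "\<lambda>v. if take (length w) v = w then f (drop (length w) v) else 0"
  assume "(\<lambda>v. (cmod (f v))\<^sup>2) summable_on UNIV"
  then have "((\<lambda>v. (cmod (?g v))\<^sup>2) \<circ> append w) summable_on UNIV"
    by (simp add: o_def)
  then have "(\<lambda>v. (cmod (?g v))\<^sup>2) summable_on range (append w)"
    by (subst summable_on_reindex) (auto intro: injI)
  moreover have "(\<lambda>v. (cmod (?g v))\<^sup>2) summable_on range (append w)
      \<longleftrightarrow> (\<lambda>v. (cmod (?g v))\<^sup>2) summable_on UNIV"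
    by (rule summable_on_cong_neutral) (auto simp: image_iff, metis append_take_drop_id)
  ultimately show "(\<lambda>v. (cmod (?g v))\<^sup>2) summable_on UNIV"
    by simp
qed

lemma left_shift_ket: "left_shift w (ket v) = ket (w @ v)"
  by transfer (auto simp: fun_eq_iff, metis append_take_drop_id)

lemma norm_left_shift: "norm (left_shift w f) = norm f"
proof -
  let ?h = "\<lambda>v. (cmod (ell2_nth (left_shift w f) v))\<^sup>2"
  have "infsum ?h UNIV = infsum ?h (range (append w))"
    by (rule infsum_cong_neutral)
      (auto simp: image_iff left_shift.rep_eq, metis append_take_drop_id)
  also have "\<dots> = infsum (?h \<circ> append w) UNIV"
    by (rule infsum_reindex) (auto intro: injI)
  also have "\<dots> = (\<Sum>\<^sub>\<infinity>v. (cmod (ell2_nth f v))\<^sup>2)"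
    by (simp add: o_def left_shift.rep_eq)
  finally show ?thesis
    by (simp add: norm_ell2_def)
qed

lift_definition left_op :: "'n list \<Rightarrow> 'n list ell2 \<Rightarrow>\<^sub>L 'n list ell2" is left_shift
proof (rule bounded_linear_intro)
  fix w :: "'n list" and x y :: "'n list ell2" and r :: real
  show "left_shift w (x + y) = left_shift w x + left_shift w y"
    "left_shift w (r *\<^sub>R x) = r *\<^sub>R left_shift w x"
    by (transfer; auto)+
  show "norm (left_shift w x) \<le> norm x * 1"
    by (simp add: norm_left_shift)
qed

definition nc_toeplitz :: "('n::finite list ell2 \<Rightarrow>\<^sub>L 'n list ell2) set" where
  "nc_toeplitz =
     (\<lambda>A. unital_subalgebra A \<and> closedin weak_operator_topology A) hull range (\<lambda>i. left_op [i])"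

end

theory Submission
  imports Defs
begin

text \<open>
  Every \<open>L\<close> in the analytic Toeplitz algebra commutes with the right creation operators
  \<open>R\<^sub>x : \<xi>\<^sub>v \<mapsto> \<xi>\<^sub>v\<^sub>x\<close>, because the generators do and commuting with fixed operators survives sums,
  products and weak operator limits (\<open>nc_toeplitz_commutes_right_shift\<close>). Hence \<open>L\<close> is determined
  by \<open>L \<xi>\<^sub>1\<close>: if \<open>R\<^sub>v\<close> appends the whole word \<open>v\<close>, then \<open>L \<xi>\<^sub>v = R\<^sub>v L \<xi>\<^sub>1\<close>, which is \<open>a \<xi>\<^sub>v\<close> plus
  terms of longer words, where \<open>a\<close> is the coefficient of \<open>\<xi>\<^sub>1\<close> in \<open>L \<xi>\<^sub>1\<close>. So \<open>L\<^sup>*\<close> is triangular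
  with respect to word length, with the constant \<open>cnj a\<close> on the diagonal
  (\<open>adjoint_ket_decomposition\<close>).

  If \<open>\<bar>a\<bar> < 1\<close>, then the powers of the contraction \<open>L\<^sup>*\<close> tend to zero on every basis vector, by
  induction on the length of the word (\<open>stable_eigenvector_modulo_stable\<close>), and therefore
  everywhere, since the vectors on which the powers of a contraction tend to zero form a closed
  subspace (\<open>stable_vectors_closed\<close>). If \<open>\<bar>a\<bar> \<ge> 1\<close>, then \<open>\<parallel>L \<xi>\<^sub>1\<parallel> \<le> 1\<close> leaves no room for further
  coefficients: \<open>L \<xi>\<^sub>1 = a \<xi>\<^sub>1\<close> with \<open>\<bar>a\<bar> = 1\<close>, and \<open>L\<close> is the unitary \<open>a I\<close>
  (\<open>contraction_unimodular_diagonal_unitary\<close>).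
\<close>

section \<open>Basis vectors and adjoints\<close>

lemma cinner_ket_right: "cinner f (ket w) = ell2_nth f w"
  by (subst cinner_commute) (simp add: cinner_ket_left)

text \<open>
  Every vector is the limit of its finite truncations (\<open>trunc_tendsto\<close>), which are linear
  combinations of basis vectors.
\<close>
lemma closed_subspace_kets_UNIV:
  assumes "closed N" and "\<And>w. ket w \<in> N" and "0 \<in> N"
    and "\<And>x y. x \<in> N \<Longrightarrow> y \<in> N \<Longrightarrow> x + y \<in> N"
    and "\<And>c x. x \<in> N \<Longrightarrow> cscale c x \<in> N"
  shows "x \<in> N"
proof -
  have "ell2_trunc F c \<in> N" for F c
    unfolding ell2_trunc_def
    by (induction F rule: infinite_finite_induct) (auto intro: assms)
  then show ?thesis
    by (intro Lim_in_closed_set[OF assms(1) _ _ trunc_tendsto]) auto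
qed

lemma cadjoint_eqI:
  assumes "T \<in> bounded_ops" "S \<in> bounded_ops"
    and "\<And>x y. cinner (blinfun_apply T x) y = cinner x (blinfun_apply S y)"
  shows "cadjoint T = S"
  unfolding cadjoint_def
  by (rule the1_equality[OF adjoint_op_ex1[OF assms(1)]]) (use assms in blast)

lemma
  assumes "T \<in> bounded_ops"
  shows cadjoint_bounded_ops: "cadjoint T \<in> bounded_ops"
    and cinner_cadjoint: "cinner (blinfun_apply T x) y = cinner x (blinfun_apply (cadjoint T) y)"
  using theI'[OF adjoint_op_ex1[OF assms], folded cadjoint_def] by blast+

lemma ell2_nth_cadjoint_ket:
  assumes "T \<in> bounded_ops"
  shows "ell2_nth (blinfun_apply (cadjoint T) (ket v)) w = cnj (ell2_nth (blinfun_apply T (ket w)) v)"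
proof -
  have "ell2_nth (cadjoint T (ket v)) w = cnj (cinner (ket w) (cadjoint T (ket v)))"
    by (simp add: cinner_ket_left)
  then show ?thesis
    by (simp add: cinner_cadjoint[OF assms, symmetric] cinner_ket_right)
qed

lemma cinner_self: "cinner f f = complex_of_real ((norm f)\<^sup>2)"
proof (rule complex_eqI)
  have "Im (cinner f f) = Im (cnj (cinner f f))" by (rule arg_cong[OF cinner_commute])
  then show "Im (cinner f f) = Im (complex_of_real ((norm f)\<^sup>2))"
    unfolding cnj.sel(2) Im_complex_of_real by linarith
  show "Re (cinner f f) = Re (complex_of_real ((norm f)\<^sup>2))"
    unfolding power2_norm_eq_inner Re_complex_of_real by (rule inner_ell2_def[symmetric])
qed

text \<open>The identity \<open>\<parallel>T\<^sup>* y\<parallel>\<^sup>2 = \<langle>T T\<^sup>* y, y\<rangle>\<close> turns the bound on \<open>T\<close> into one on \<open>T\<^sup>*\<close>.\<close>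
lemma norm_cadjoint_apply_le:
  assumes "T \<in> bounded_ops" "norm T \<le> 1"
  shows "norm (blinfun_apply (cadjoint T) y) \<le> norm y"
proof -
  let ?z = "cadjoint T y"
  have "(norm ?z)\<^sup>2 = cmod (cinner (T ?z) y)"
    unfolding cinner_cadjoint[OF assms(1)] cinner_self by (simp add: norm_power)
  also have "\<dots> \<le> norm (T ?z) * norm y" by (rule cmod_cinner_le)
  also have "\<dots> \<le> norm ?z * norm y"
    using norm_blinfun[of T ?z] mult_right_mono[OF assms(2) norm_ge_zero[of ?z]]
    by (intro mult_right_mono) auto
  finally show ?thesis
    by (cases "norm ?z = 0") (auto simp: power2_eq_square mult_le_cancel_left simp del: norm_eq_zero)
qed

section \<open>Commutation with the right shifts\<close>

text \<open>
  A single appended letter is enough, since the words are reached by repetition; membership in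
  \<open>\<ell>\<^sub>2\<close> holds because the shift only relabels the coordinates by the injection \<open>v \<mapsto> vx\<close>.
\<close>
lift_definition right_shift :: "'n \<Rightarrow> 'n list ell2 \<Rightarrow> 'n list ell2" is
  "\<lambda>x f v. if v \<noteq> [] \<and> last v = x then f (butlast v) else 0"
proof -
  fix x :: 'n and f :: "'n list \<Rightarrow> complex"
  let ?e = "\<lambda>v. v @ [x]"
  let ?g = "\<lambda>v. if v \<noteq> [] \<and> last v = x then f (butlast v) else 0"
  assume "(\<lambda>v. (cmod (f v))\<^sup>2) summable_on UNIV"
  then have "((\<lambda>v. (cmod (?g v))\<^sup>2) \<circ> ?e) summable_on UNIV"
    by (simp add: o_def)
  then have "(\<lambda>v. (cmod (?g v))\<^sup>2) summable_on range ?e"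
    by (subst summable_on_reindex) (auto intro: injI)
  moreover have "(\<lambda>v. (cmod (?g v))\<^sup>2) summable_on range ?e
      \<longleftrightarrow> (\<lambda>v. (cmod (?g v))\<^sup>2) summable_on UNIV"
    by (rule summable_on_cong_neutral) (auto simp: image_iff, metis append_butlast_last_id)
  ultimately show "(\<lambda>v. (cmod (?g v))\<^sup>2) summable_on UNIV"
    by simp
qed

lemma right_shift_ket: "right_shift x (ket v) = ket (v @ [x])"
  by transfer (auto simp: fun_eq_iff)

lemma right_shift_add: "right_shift x (f + g) = right_shift x f + right_shift x g"
  by transfer auto

lemma right_shift_cscale: "right_shift x (cscale c f) = cscale c (right_shift x f)"
  by transfer auto

lemma left_right_shift_commute:
  "left_shift [i] (right_shift x f) = right_shift x (left_shift [i] f)"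
proof (rule ell2_eqI)
  fix v
  show "ell2_nth (left_shift [i] (right_shift x f)) v = ell2_nth (right_shift x (left_shift [i] f)) v"
    by (cases v; cases "tl v" rule: rev_cases)
      (auto simp: left_shift.rep_eq right_shift.rep_eq)
qed

lemma bounded_ops_compose:
  "S \<in> bounded_ops \<Longrightarrow> T \<in> bounded_ops \<Longrightarrow> S o\<^sub>L T \<in> bounded_ops"
  by (simp add: bounded_ops_def)

lemma scalar_op_bounded_ops: "scalar_op c \<in> bounded_ops"
  by (auto simp: bounded_ops_def scalar_op.rep_eq cscale.rep_eq intro!: ell2_eqI)

lemma bounded_ops_add:
  "S \<in> bounded_ops \<Longrightarrow> T \<in> bounded_ops \<Longrightarrow> S + T \<in> bounded_ops"
  by (auto simp: bounded_ops_def blinfun.add_left cscale.rep_eq plus_ell2.rep_eq algebra_simps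
      intro!: ell2_eqI)

lemma left_op_bounded_ops: "left_op w \<in> bounded_ops"
  by (auto simp: bounded_ops_def left_op.rep_eq left_shift.rep_eq cscale.rep_eq intro!: ell2_eqI)

lemma topspace_weak_operator_topology: "topspace weak_operator_topology = bounded_ops"
  by (simp add: weak_operator_topology_def topspace_pullback_topology)

lemma continuous_map_coefficient:
  "continuous_map weak_operator_topology euclidean (\<lambda>T. ell2_nth (blinfun_apply T f) v)"
proof -
  have "continuous_map weak_operator_topology euclidean
      ((\<lambda>h. h (f, ket v)) \<circ> (\<lambda>T (x, y). cinner (blinfun_apply T x) y))"
    unfolding weak_operator_topology_def
    by (rule continuous_map_pullback) (simp add: continuous_on_product_coordinates)
  then show ?thesis by (simp add: o_def cinner_ket_right)
qed

text \<open>
  Both sides of the commutation relation have, coordinate by coordinate, a weakly continuous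
  dependence on the operator: a coordinate of \<open>R\<^sub>x T f\<close> is either zero or a coordinate of \<open>T f\<close>.
\<close>
lemma closedin_commutant_right_shift:
  "closedin weak_operator_topology
     {T :: 'n list ell2 \<Rightarrow>\<^sub>L 'n list ell2. T \<in> bounded_ops \<and>
       (\<forall>x f. blinfun_apply T (right_shift x f) = right_shift x (blinfun_apply T f))}"
proof -
  let ?C = "\<lambda>x f v. {T :: 'n list ell2 \<Rightarrow>\<^sub>L 'n list ell2. T \<in> topspace weak_operator_topology \<and>
    ell2_nth (blinfun_apply T (right_shift x f)) v =
      ell2_nth (right_shift x (blinfun_apply T f)) v}"
  have "closedin weak_operator_topology (?C x f v)" for x f v
  proof (rule closedin_continuous_maps_eq[where Y = euclidean])
    show "continuous_map weak_operator_topology euclidean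
        (\<lambda>T. ell2_nth (right_shift x (blinfun_apply T f)) v)"
      by (cases "v \<noteq> [] \<and> last v = x")
        (simp_all add: right_shift.rep_eq continuous_map_coefficient cong: if_cong)
  qed (simp_all add: continuous_map_coefficient)
  then have "closedin weak_operator_topology (\<Inter>(x, f, v)\<in>UNIV. ?C x f v)"
    by (intro closedin_INT) auto
  moreover have "(\<Inter>(x, f, v)\<in>UNIV. ?C x f v) = {T \<in> bounded_ops.
      \<forall>x f. blinfun_apply T (right_shift x f) = right_shift x (blinfun_apply T f)}"
    unfolding topspace_weak_operator_topology by (auto intro: ell2_eqI)
  ultimately show ?thesis by (simp only:)
qed

lemma nc_toeplitz_commutes_right_shift:
  fixes T :: "'n::finite list ell2 \<Rightarrow>\<^sub>L 'n list ell2"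
  assumes "T \<in> nc_toeplitz"
  shows "T \<in> bounded_ops"
    and "blinfun_apply T (right_shift x f) = right_shift x (blinfun_apply T f)"
proof -
  let ?A = "{T :: 'n list ell2 \<Rightarrow>\<^sub>L 'n list ell2. T \<in> bounded_ops \<and>
    (\<forall>x f. blinfun_apply T (right_shift x f) = right_shift x (blinfun_apply T f))}"
  have "unital_subalgebra ?A"
    unfolding unital_subalgebra_def
    by (auto simp: bounded_ops_compose bounded_ops_add scalar_op_bounded_ops blinfun.add_left
        right_shift_add right_shift_cscale scalar_op.rep_eq)
      (simp add: bounded_ops_def)
  moreover have "range (\<lambda>i. left_op [i]) \<subseteq> ?A"
    by (auto simp: left_op_bounded_ops left_op.rep_eq left_right_shift_commute)
  ultimately have "nc_toeplitz \<subseteq> ?A"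
    unfolding nc_toeplitz_def using closedin_commutant_right_shift by (intro hull_minimal) auto
  then show "T \<in> bounded_ops"
    and "blinfun_apply T (right_shift x f) = right_shift x (blinfun_apply T f)"
    using assms by auto
qed

section \<open>Triangularity with respect to word length\<close>

text \<open>
  The last letter of \<open>w\<close> is moved out of \<open>T\<close> as a right shift, which strips it from \<open>v\<close> as well;
  as \<open>v\<close> is not longer than \<open>w\<close>, nothing but the constant term of \<open>T \<xi>\<^sub>1\<close> can be reached.
\<close>
lemma coefficient_triangular:
  fixes T :: "'n list ell2 \<Rightarrow>\<^sub>L 'n list ell2"
  assumes comm: "\<And>x f. blinfun_apply T (right_shift x f) = right_shift x (blinfun_apply T f)"
    and "length v \<le> length w"
  shows "ell2_nth (blinfun_apply T (ket w)) v =
    (if v = w then ell2_nth (blinfun_apply T (ket [])) [] else 0)"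
  using assms(2)
proof (induction w arbitrary: v rule: rev_induct)
  case (snoc x w)
  have "ell2_nth (blinfun_apply T (ket (w @ [x]))) v =
      (if v \<noteq> [] \<and> last v = x then ell2_nth (blinfun_apply T (ket w)) (butlast v) else 0)"
    by (simp add: right_shift_ket[symmetric] comm right_shift.rep_eq)
  then show ?case
    using snoc.IH[of "butlast v"] snoc.prems by (cases v rule: rev_cases) auto
qed auto

text \<open>
  The coordinates of \<open>T\<^sup>* \<xi>\<^sub>v\<close> form a row of the matrix of \<open>T\<close>. As the alphabet is finite,
  there are only finitely many words shorter than \<open>v\<close>, so the remainder is a finite combination.
\<close>
lemma adjoint_ket_decomposition:
  fixes T :: "'n::finite list ell2 \<Rightarrow>\<^sub>L 'n list ell2"
  assumes "T \<in> bounded_ops"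
    and comm: "\<And>x f. blinfun_apply T (right_shift x f) = right_shift x (blinfun_apply T f)"
  defines "a \<equiv> ell2_nth (blinfun_apply T (ket [])) []"
  shows "\<exists>c. blinfun_apply (cadjoint T) (ket v) =
    cscale (cnj a) (ket v) + ell2_trunc {w. length w < length v} c"
proof -
  have fin: "finite {w :: 'n list. length w < length v}"
    using finite_lists_length_le[OF finite_class.finite_UNIV, of "length v"]
    by (rule rev_finite_subset) auto
  have "blinfun_apply (cadjoint T) (ket v) = cscale (cnj a) (ket v) +
    ell2_trunc {w. length w < length v} (\<lambda>w. cnj (ell2_nth (blinfun_apply T (ket w)) v))"
  proof (rule ell2_eqI)
    fix w
    have "ell2_nth (blinfun_apply T (ket w)) v = (if v = w then a else 0)"
      if "\<not> length w < length v"
      unfolding a_def by (rule coefficient_triangular[OF comm]) (use that in simp)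
    then show "ell2_nth (blinfun_apply (cadjoint T) (ket v)) w = ell2_nth (cscale (cnj a) (ket v) +
      ell2_trunc {w. length w < length v} (\<lambda>w. cnj (ell2_nth (blinfun_apply T (ket w)) v))) w"
      by (auto simp: ell2_nth_cadjoint_ket[OF assms(1)] plus_ell2.rep_eq cscale.rep_eq ket.rep_eq
          ell2_nth_trunc[OF fin])
  qed
  then show ?thesis by blast
qed

section \<open>A unimodular diagonal\<close>

lemma ell2_nth_sq_sum_le:
  assumes "finite F"
  shows "(\<Sum>w\<in>F. (cmod (ell2_nth f w))\<^sup>2) \<le> (norm f)\<^sup>2"
  unfolding norm_ell2_sq using assms by (intro finite_sum_le_infsum ell2_summable) auto

lemma unitary_scalar_op:
  assumes "cmod a = 1"
  shows "unitary_op (scalar_op a)"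
proof -
  have "cinner (cscale a x) y = cinner x (cscale (cnj a) y)" for x y :: "'a ell2"
    by (simp add: cinner_cscale_left cinner_commute[of x])
  then have adj: "cadjoint (scalar_op a) = (scalar_op (cnj a) :: 'a ell2 \<Rightarrow>\<^sub>L 'a ell2)"
    by (intro cadjoint_eqI scalar_op_bounded_ops) (simp add: scalar_op.rep_eq)
  have "a * cnj a = 1" using assms by (simp add: complex_norm_square[symmetric])
  then show ?thesis
    unfolding unitary_op_def adj
    by (auto simp: scalar_op_bounded_ops scalar_op.rep_eq cscale.rep_eq
        mult.assoc[symmetric] mult.commute[of "cnj a"] intro!: blinfun_eqI ell2_eqI)
qed

text \<open>
  The coefficient \<open>a\<close> alone exhausts the norm of \<open>T \<xi>\<^sub>1\<close>, so \<open>T \<xi>\<^sub>1 = a \<xi>\<^sub>1\<close>. Commutation with the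
  right shifts carries this to every basis vector, and density to the whole space.
\<close>
lemma contraction_unimodular_diagonal_unitary:
  fixes T :: "'n list ell2 \<Rightarrow>\<^sub>L 'n list ell2"
  assumes T: "T \<in> bounded_ops" "norm T \<le> 1"
    and comm: "\<And>x f. blinfun_apply T (right_shift x f) = right_shift x (blinfun_apply T f)"
    and a1: "cmod (ell2_nth (blinfun_apply T (ket [])) []) \<ge> 1"
  shows "unitary_op T"
proof -
  define a where "a = ell2_nth (blinfun_apply T (ket [])) []"
  let ?f = "blinfun_apply T (ket [])"
  have "(ket [] :: 'n list ell2) = ell2_trunc {[]} (\<lambda>_. 1)"
    by (rule ell2_eqI) (simp add: ell2_nth_trunc ket.rep_eq)
  then have "(norm (ket [] :: 'n list ell2))\<^sup>2 = 1" by (simp add: norm_trunc_sq)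
  then have "norm (ket [] :: 'n list ell2) = 1"
    by (simp add: power2_eq_1_iff) (metis norm_ge_zero not_one_le_zero neg_0_le_iff_le)
  then have "norm ?f \<le> 1" using norm_blinfun[of T "ket []"] T(2) by simp
  then have f1: "(norm ?f)\<^sup>2 \<le> 1" by (simp add: power_le_one)
  have a_sq: "1 \<le> (cmod a)\<^sup>2" using a1 by (simp add: a_def)
  have "cmod a = 1"
    using ell2_nth_sq_sum_le[of "{[]}" ?f] f1 a1 by (simp add: a_def abs_square_le_1)
  have "ell2_nth ?f w = 0" if "w \<noteq> []" for w
  proof -
    have "(cmod a)\<^sup>2 + (cmod (ell2_nth ?f w))\<^sup>2 \<le> 1"
      using ell2_nth_sq_sum_le[of "{[], w}" ?f] f1 that by (simp add: a_def)
    then have "(cmod (ell2_nth ?f w))\<^sup>2 \<le> 0" using a_sq by linarith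
    then show ?thesis by simp
  qed
  then have "?f = cscale a (ket [])"
    by (intro ell2_eqI) (simp add: cscale.rep_eq ket.rep_eq a_def)
  then have ket: "blinfun_apply T (ket v) = cscale a (ket v)" for v
    by (induction v rule: rev_induct)
      (simp_all add: right_shift_ket[symmetric] comm right_shift_cscale)
  have "x \<in> {x. blinfun_apply T x = blinfun_apply (scalar_op a) x}" for x
  proof (rule closed_subspace_kets_UNIV)
    show "closed {x. blinfun_apply T x = blinfun_apply (scalar_op a) x}"
      by (intro closed_Collect_eq continuous_intros)
    show "ket w \<in> {x. blinfun_apply T x = blinfun_apply (scalar_op a) x}" for w
      by (simp add: ket scalar_op.rep_eq)
  qed (use T(1) scalar_op_bounded_ops[of a, where 'a = "'n list"] in
      \<open>auto simp: blinfun.add_right bounded_ops_def\<close>)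
  then have "T = scalar_op a" by (auto intro: blinfun_eqI)
  then show ?thesis using unitary_scalar_op \<open>cmod a = 1\<close> by simp
qed

section \<open>Powers of a contraction that tend to zero\<close>

text \<open>The powers of a contraction are uniformly bounded, so convergence to zero passes to limits.\<close>
lemma stable_vectors_closed:
  fixes S :: "'a::real_normed_vector \<Rightarrow>\<^sub>L 'a"
  assumes contr: "\<And>x. norm (blinfun_apply S x) \<le> norm x"
  shows "closed {x. (\<lambda>k. norm ((blinfun_apply S ^^ k) x)) \<longlonglongrightarrow> 0}" (is "closed ?N")
proof -
  have pow: "norm ((blinfun_apply S ^^ k) x) \<le> norm x" for k x
    by (induction k) (auto intro: order_trans[OF contr])
  have diff: "(blinfun_apply S ^^ k) (x - y) = (blinfun_apply S ^^ k) x - (blinfun_apply S ^^ k) y"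
    for k x y
    by (induction k) (auto simp: blinfun.diff_right)
  have "x \<in> ?N" if x: "x \<in> closure ?N" for x
  proof -
    have "\<exists>m. \<forall>k\<ge>m. norm ((blinfun_apply S ^^ k) x) < e" if "e > 0" for e
    proof -
      obtain y where y: "y \<in> ?N" "dist y x < e / 2"
        using x \<open>e > 0\<close> unfolding closure_approachable by (meson half_gt_zero)
      obtain m where m: "norm ((blinfun_apply S ^^ k) y) < e / 2" if "k \<ge> m" for k
        using y(1) order_tendstoD(2)[of _ 0 sequentially "e / 2"] \<open>e > 0\<close>
        by (auto simp: eventually_sequentially)
      have "norm ((blinfun_apply S ^^ k) x) < e" if "k \<ge> m" for k
        using m[OF that] pow[of k "x - y"] y(2)
          norm_triangle_ineq2[of "(blinfun_apply S ^^ k) x" "(blinfun_apply S ^^ k) y"]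
        unfolding diff by (simp add: dist_norm norm_minus_commute)
      then show ?thesis by blast
    qed
    then show ?thesis by (simp add: lim_sequentially)
  qed
  then show ?thesis by (metis closure_subset_eq subsetI)
qed

text \<open>
  The norms \<open>\<parallel>S\<^sup>k x\<parallel>\<close> decrease to some \<open>l \<ge> 0\<close>, and applying \<open>S\<^sup>k\<close> to \<open>S x = b x + y\<close> gives
  \<open>l \<le> \<bar>b\<bar> l\<close> in the limit.
\<close>
lemma stable_eigenvector_modulo_stable:
  assumes S: "S \<in> bounded_ops" and contr: "\<And>x. norm (blinfun_apply S x) \<le> norm x"
    and b: "cmod b < 1"
    and eq: "blinfun_apply S x = cscale b x + y"
    and y: "(\<lambda>k. norm ((blinfun_apply S ^^ k) y)) \<longlonglongrightarrow> 0"
  shows "(\<lambda>k. norm ((blinfun_apply S ^^ k) x)) \<longlonglongrightarrow> 0"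
proof -
  let ?n = "\<lambda>k. norm ((blinfun_apply S ^^ k) x)"
  have "decseq ?n" by (rule decseq_SucI) (simp add: contr)
  then obtain l where l: "?n \<longlonglongrightarrow> l" using decseq_convergent[of ?n 0] by auto
  have "l \<ge> 0" by (rule LIMSEQ_le_const[OF l]) auto
  have "(blinfun_apply S ^^ k) (cscale b x + y) =
      cscale b ((blinfun_apply S ^^ k) x) + (blinfun_apply S ^^ k) y" for k
    using S by (induction k) (auto simp: blinfun.add_right bounded_ops_def)
  then have "?n (Suc k) \<le> cmod b * ?n k + norm ((blinfun_apply S ^^ k) y)" for k
    unfolding funpow_Suc_right o_apply eq by (metis norm_cscale norm_triangle_ineq)
  then have "l \<le> cmod b * l + 0"
    by (intro LIMSEQ_le[OF LIMSEQ_Suc[OF l] tendsto_add[OF tendsto_mult_left[OF l] y]]) auto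
  then have "l = 0" using b \<open>l \<ge> 0\<close> mult_le_cancel_right1[of l "cmod b"] by auto
  then show ?thesis using l by simp
qed

theorem lemma1p2:
  fixes L :: "'n::finite list ell2 \<Rightarrow>\<^sub>L 'n list ell2"
  assumes "L \<in> nc_toeplitz"
    and "norm L \<le> 1"
    and "\<not> unitary_op L"
  shows "\<forall>\<xi>. (\<lambda>k. norm ((blinfun_apply (cadjoint L) ^^ k) \<xi>)) \<longlonglongrightarrow> 0"
proof
  fix \<xi> :: "'n list ell2"
  note L = nc_toeplitz_commutes_right_shift[OF assms(1)]
  let ?S = "blinfun_apply (cadjoint L)"
  let ?N = "{x. (\<lambda>k. norm ((?S ^^ k) x)) \<longlonglongrightarrow> 0}"
  define a where "a = ell2_nth (blinfun_apply L (ket [])) []"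
  have a: "cmod (cnj a) < 1"
    using contraction_unimodular_diagonal_unitary[OF L(1) assms(2) L(2)] assms(3)
    by (force simp: a_def)
  note S = cadjoint_bounded_ops[OF L(1)] norm_cadjoint_apply_le[OF L(1) assms(2)]
  have zero: "(?S ^^ k) 0 = 0" for k
    by (induction k) auto
  have add: "x + y \<in> ?N" if "x \<in> ?N" "y \<in> ?N" for x y
  proof -
    have "(?S ^^ k) (x + y) = (?S ^^ k) x + (?S ^^ k) y" for k
      by (induction k) (auto simp: blinfun.add_right)
    then show ?thesis
      using that tendsto_add[of "\<lambda>k. (?S ^^ k) x" 0 sequentially "\<lambda>k. (?S ^^ k) y" 0]
      by (simp add: tendsto_norm_zero_iff)
  qed
  have scale: "cscale c x \<in> ?N" if "x \<in> ?N" for c x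
  proof -
    have "(?S ^^ k) (cscale c x) = cscale c ((?S ^^ k) x)" for k
      using S(1) by (induction k) (auto simp: bounded_ops_def)
    then show ?thesis
      using that tendsto_mult_right_zero[of "\<lambda>k. norm ((?S ^^ k) x)" sequentially "cmod c"]
      by (simp add: norm_cscale)
  qed
  have trunc: "ell2_trunc F c \<in> ?N" if "\<forall>w\<in>F. ket w \<in> ?N" for F c
    using that unfolding ell2_trunc_def
    by (induction F rule: infinite_finite_induct)
      (auto simp: zero intro!: add[simplified] scale[simplified])
  have "ket v \<in> ?N" for v
  proof (induction v rule: length_induct)
    case (1 v)
    obtain c where eq: "?S (ket v) = cscale (cnj a) (ket v) + ell2_trunc {w. length w < length v} c"
      using adjoint_ket_decomposition[OF L] unfolding a_def by blast
    have "ell2_trunc {w. length w < length v} c \<in> ?N"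
      by (rule trunc) (use 1 in simp)
    then show ?case
      using stable_eigenvector_modulo_stable[OF S a eq] by simp
  qed
  then have "\<xi> \<in> ?N"
    by (rule closed_subspace_kets_UNIV[OF stable_vectors_closed[OF S(2)] _ _ add scale])
      (simp_all add: zero)
  then show "(\<lambda>k. norm ((?S ^^ k) \<xi>)) \<longlonglongrightarrow> 0" by simp
qed

end
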